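(* Let $s>1$, let $\phi:[2\pi,+\infty)\to(0,\infty)$ be a continuous function with $\lim_{t\to\infty}\phi(t)=0$, and suppose that the spiral $\mathcal{S}_\phi$ is an almost circular spiral arc. Then $\mathcal{S}_\phi$ is a $(1/s)$-H\"older arc if, and only if, the series $\sum_{n=1}^\infty \phi_n^s$ converges.
   Context: The complex plane $\mathbb{C}$ is identified with $\mathbb{R}^2$ and carries the Euclidean metric; $\mathbf{i}$ is the imaginary unit and $\mathbb{N}=\{1,2,\dots\}$. For a continuous $\phi:[2\pi,+\infty)\to(0,\infty)$ with $\lim_{t\to\infty}\phi(t)=0$, the spiral $\mathcal{S}_\phi$ is the set $$\mathcal{S}_\phi=\{\phi(t)e^{\mathbf{i}t}: t\in[2\pi,+\infty)\}\cup\{0\}$$ with the Euclidean metric. It is a spiral arc if it has no self-intersections, i.e. $t\mapsto \phi(t)e^{\mathbf{i}t}$ is injective on $[2\pi,+\infty)$. For $j\in\mathbb{N}$ set $\mathcal{S}_\phi^j=\{\phi(t)e^{\mathbf{i}t}: t\in[2\pi j,2\pi(j+1)]\}$ and $\phi_j=\max\{\phi(t): t\in[2\pi j,2\pi(j+1)]\}$. The spiral $\mathcal{S}_\phi$ is almost circular if there is $C_\phi>0$ such that $\ell(\mathcal{S}_\phi^j)\le C_\phi\phi_j$ for all $j\in\mathbb{N}$, where $\ell$ denotes length. A map $f:X\to Y$ between metric spaces is $\alpha$-H\"older if there is $C>0$ with $d_Y(f(x_1),f(x_2))\le C\,d_X(x_1,x_2)^\alpha$ for all $x_1,x_2\in X$.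 A metric space $X$ is an $\alpha$-H\"older arc if there is an $\alpha$-H\"older homeomorphism $f$ from $[0,1]$ onto $X$. *)

theory Defs
  imports "HOL-Analysis.Analysis"
begin

(* A function on [2 pi, oo) is represented by a total function real => real;
   its values to the left of 2 pi are irrelevant, since turns are only used for j >= 1. *)

definition spiral_curve :: "(real \<Rightarrow> real) \<Rightarrow> real \<Rightarrow> complex" where
  "spiral_curve \<phi> t = of_real (\<phi> t) * exp (\<i> * of_real t)"

definition spiral :: "(real \<Rightarrow> real) \<Rightarrow> complex set" where
  "spiral \<phi> = spiral_curve \<phi> ` {2 * pi..} \<union> {0}"

definition spiral_arc :: "(real \<Rightarrow> real) \<Rightarrow> bool" where
  "spiral_arc \<phi> \<longleftrightarrow> inj_on (spiral_curve \<phi>) {2 * pi..}"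

definition turn_interval :: "nat \<Rightarrow> real set" where
  "turn_interval j = {2 * pi * real j..2 * pi * (real j + 1)}"

(* Max is only meaningful on finite sets, hence the supremum; it is attained for
   continuous functions, see turn_max_attained. *)
definition turn_max :: "(real \<Rightarrow> real) \<Rightarrow> nat \<Rightarrow> real" where
  "turn_max \<phi> j = (SUP t\<in>turn_interval j. \<phi> t)"

lemma turn_max_attained:
  assumes "continuous_on {2 * pi..} \<phi>" and "j \<ge> 1"
  shows "\<exists>t\<in>turn_interval j. \<phi> t = turn_max \<phi> j \<and> (\<forall>u\<in>turn_interval j. \<phi> u \<le> \<phi> t)"
proof -
  have "2 * pi * 1 \<le> 2 * pi * real j"
    using assms(2) by (intro mult_left_mono) auto
  then have "turn_interval j \<subseteq> {2 * pi..}"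
    by (auto simp: turn_interval_def)
  then have cont: "continuous_on (turn_interval j) \<phi>"
    using assms(1) continuous_on_subset by blast
  have "compact (turn_interval j)" "turn_interval j \<noteq> {}"
    by (auto simp: turn_interval_def)
  then obtain t where t: "t \<in> turn_interval j" "\<forall>u\<in>turn_interval j. \<phi> u \<le> \<phi> t"
    using continuous_attains_sup[OF _ _ cont] by blast
  then have "turn_max \<phi> j = \<phi> t"
    unfolding turn_max_def by (intro cSup_eq_maximum) auto
  with t show ?thesis by auto
qed

(* Length as the supremum over the partitions a = p 0 <= ... <= p n = b of the lengths
   of the inscribed polygons; it is infinite for non-rectifiable curves. *)
definition curve_length :: "(real \<Rightarrow> 'a::metric_space) \<Rightarrow> real \<Rightarrow> real \<Rightarrow> ennreal" where
  "curve_length \<gamma> a b =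
     Sup {ennreal (\<Sum>i<n. dist (\<gamma> (p i)) (\<gamma> (p (Suc i)))) | (n::nat) (p::nat \<Rightarrow> real).
            p 0 = a \<and> p n = b \<and> (\<forall>i<n. p i \<le> p (Suc i))}"

(* The length of the j-th turn is that of its parametrisation by the angle t. For a spiral
   arc this parametrisation is injective, so it is also the length of the image as an arc. *)
definition almost_circular :: "(real \<Rightarrow> real) \<Rightarrow> bool" where
  "almost_circular \<phi> \<longleftrightarrow>
     (\<exists>C>0. \<forall>j\<ge>1. curve_length (spiral_curve \<phi>) (2 * pi * real j) (2 * pi * (real j + 1))
                  \<le> ennreal (C * turn_max \<phi> j))"

definition holder_on ::
    "real \<Rightarrow> 'a::metric_space set \<Rightarrow> ('a \<Rightarrow> 'b::metric_space) \<Rightarrow> bool" where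
  "holder_on \<alpha> X f \<longleftrightarrow>
     (\<exists>C>0. \<forall>x\<in>X. \<forall>y\<in>X. dist (f x) (f y) \<le> C * dist x y powr \<alpha>)"

definition holder_arc :: "real \<Rightarrow> 'a::metric_space set \<Rightarrow> bool" where
  "holder_arc \<alpha> X \<longleftrightarrow>
     (\<exists>f g. homeomorphism {0..1::real} X f g \<and> holder_on \<alpha> {0..1} f)"

end

theory Submission
  imports Defs
begin

text \<open>
  Write \<open>\<gamma>(t) = \<phi>(t) exp(\<i>t)\<close> and \<open>\<phi>\<^sub>j\<close> for the maximal radius on the \<open>j\<close>-th turn.
  Since \<open>\<gamma>\<close> is injective, \<open>\<phi>(t + 2\<pi>) - \<phi>(t)\<close> never vanishes, so it has a constant sign, and
  as \<open>\<phi>\<close> is positive and tends to \<open>0\<close> the sign is negative (\<open>radius_decreases\<close>). Hence everything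
  from the \<open>j\<close>-th turn onwards lies in the disc of radius \<open>\<phi>\<^sub>j\<close>. On the other hand the \<open>j\<close>-th
  turn contains two points on opposite sides of the origin, one of them at distance \<open>\<phi>\<^sub>j\<close> from it,
  so its diameter is at least \<open>\<phi>\<^sub>j\<close> (\<open>turn_max_le_diameter\<close>).

  Suppose first that \<open>f\<close> is a \<open>1/s\<close>-Hoelder homeomorphism from the unit interval onto the spiral.
  Then \<open>f\<^sup>-\<^sup>1 \<circ> \<gamma>\<close> is continuous and injective, hence monotone, so it maps the turns to
  non-overlapping subintervals of the unit interval. The length of the \<open>j\<close>-th one is at least a
  constant times \<open>\<phi>\<^sub>j\<^sup>s\<close>, because its image under \<open>f\<close> has diameter at least \<open>\<phi>\<^sub>j\<close>. The lengths
  add up to at most \<open>1\<close>, so the series converges (\<open>summable_of_holder_arc\<close>).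

  Conversely, reparametrize the spiral so that each turn is traversed with constant speed
  and takes time \<open>\<phi>\<^sub>j\<^sup>s\<^sup>-\<^sup>1\<close> times its length. Almost circularity bounds this time by a
  multiple of \<open>\<phi>\<^sub>j\<^sup>s\<close>, so the total time is finite if the series converges, and the spiral becomes a
  curve on a compact interval. On one turn a chord \<open>d \<le> 2\<phi>\<^sub>j\<close> takes time at least
  \<open>\<phi>\<^sub>j\<^sup>s\<^sup>-\<^sup>1 d \<ge> (d/2)\<^sup>s\<close>, which is the Hoelder condition (\<open>holder_in_turn\<close>). If a complete turn \<open>j\<close> lies
  between two points, everything beyond its start is within \<open>\<phi>\<^sub>j\<close> of the origin, and traversing
  turn \<open>j\<close> alone takes time at least \<open>(\<phi>\<^sub>j/2)\<^sup>s\<close> by the diameter bound (\<open>holder_parameter\<close>).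

  The new time is continuous because arc length is a continuous function of the end point of a
  rectifiable continuous curve (\<open>continuous_on_curve_length\<close>). A strictly increasing, continuous,
  bounded time with a Hoelder estimate is all that is needed to obtain a homeomorphism with the unit
  interval (\<open>holder_arc_of_ray\<close>).
\<close>

section \<open>Length of curves\<close>

lemma polygon_le_curve_length:
  assumes "\<And>i. i < n \<Longrightarrow> p i \<le> p (Suc i)"
  shows "ennreal (\<Sum>i<n. dist (\<gamma> (p i)) (\<gamma> (p (Suc i)))) \<le> curve_length \<gamma> (p 0) (p n)"
  unfolding curve_length_def using assms by (intro Sup_upper) blast

lemma dist_le_curve_length:
  assumes "a \<le> b"
  shows "ennreal (dist (\<gamma> a) (\<gamma> b)) \<le> curve_length \<gamma> a b"
  using polygon_le_curve_length[of 1 "\<lambda>i. if i = 0 then a else b" \<gamma>] assms by simp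

lemma curve_length_refl: "curve_length \<gamma> a a = 0"
proof -
  have "(\<Sum>i<n. dist (\<gamma> (p i)) (\<gamma> (p (Suc i)))) = 0"
    if p: "p 0 = a" "p n = a" "\<forall>i<n. p i \<le> p (Suc i)" for n and p :: "nat \<Rightarrow> real"
  proof -
    have up: "a \<le> p i" if "i \<le> n" for i
      using that by (induction i) (use p in \<open>auto intro: order_trans\<close>)
    have down: "p i \<le> a" if "i \<le> n" for i
      using that by (induction rule: inc_induct) (use p in \<open>auto intro: order_trans\<close>)
    have "p i = a" if "i \<le> n" for i
      using up down that by force
    then show ?thesis by simp
  qed
  then have "curve_length \<gamma> a a \<le> 0"
    unfolding curve_length_def by (intro Sup_least) auto
  then show ?thesis by simp
qed

lemma ennreal_Sup_add_Sup_le: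
  fixes A B :: "ennreal set"
  assumes "A \<noteq> {}" "B \<noteq> {}" and "\<And>x y. x \<in> A \<Longrightarrow> y \<in> B \<Longrightarrow> x + y \<le> c"
  shows "Sup A + Sup B \<le> c"
proof -
  have "x + Sup B \<le> c" if "x \<in> A" for x
  proof -
    have "x + Sup B = (SUP y\<in>B. x + y)"
      using ennreal_SUP_add_right[OF assms(2), of x "\<lambda>y. y"] by simp
    also have "\<dots> \<le> c" using assms(3) that by (intro SUP_least)
    finally show ?thesis .
  qed
  moreover have "Sup A + Sup B = (SUP x\<in>A. x + Sup B)"
    using ennreal_SUP_add_left[OF assms(1), of "\<lambda>x. x" "Sup B"] by simp
  ultimately show ?thesis by (simp add: SUP_least)
qed

text \<open>
  Cutting a partition at \<open>b\<close> (through \<open>min\<close> and \<open>max\<close> with \<open>b\<close>) can only lengthen the inscribed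
  polygon, by the triangle inequality; conversely, partitions on both sides of \<open>b\<close> can be concatenated.
\<close>

lemma curve_length_add:
  assumes "a \<le> b" "b \<le> c"
  shows "curve_length \<gamma> a c = curve_length \<gamma> a b + curve_length \<gamma> b c"
proof (rule antisym)
  show "curve_length \<gamma> a c \<le> curve_length \<gamma> a b + curve_length \<gamma> b c"
    unfolding curve_length_def[of _ a c]
  proof (intro Sup_least, clarify)
    fix n and p :: "nat \<Rightarrow> real"
    assume p: "\<forall>i<n. p i \<le> p (Suc i)" and ends: "a = p 0" "c = p n"
    let ?q = "\<lambda>i. min (p i) b" and ?r = "\<lambda>i. max (p i) b"
    have "(\<Sum>i<n. dist (\<gamma> (p i)) (\<gamma> (p (Suc i))))
        \<le> (\<Sum>i<n. dist (\<gamma> (?q i)) (\<gamma> (?q (Suc i))) + dist (\<gamma> (?r i)) (\<gamma> (?r (Suc i))))"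
    proof (intro sum_mono)
      fix i assume "i \<in> {..<n}"
      then have "p i \<le> p (Suc i)" using p by simp
      then show "dist (\<gamma> (p i)) (\<gamma> (p (Suc i)))
          \<le> dist (\<gamma> (?q i)) (\<gamma> (?q (Suc i))) + dist (\<gamma> (?r i)) (\<gamma> (?r (Suc i)))"
        by (auto simp: min_def max_def dist_triangle)
    qed
    then have "ennreal (\<Sum>i<n. dist (\<gamma> (p i)) (\<gamma> (p (Suc i))))
        \<le> ennreal (\<Sum>i<n. dist (\<gamma> (?q i)) (\<gamma> (?q (Suc i))))
         + ennreal (\<Sum>i<n. dist (\<gamma> (?r i)) (\<gamma> (?r (Suc i))))"
      by (simp add: sum.distrib sum_nonneg flip: ennreal_plus)
    also have "\<dots> \<le> curve_length \<gamma> (?q 0) (?q n) + curve_length \<gamma> (?r 0) (?r n)"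
      using p by (intro add_mono polygon_le_curve_length) force+
    also have "\<dots> = curve_length \<gamma> (p 0) b + curve_length \<gamma> b (p n)"
      using assms ends by (simp add: min_def max_def)
    finally show "ennreal (\<Sum>i<n. dist (\<gamma> (p i)) (\<gamma> (p (Suc i))))
        \<le> curve_length \<gamma> (p 0) b + curve_length \<gamma> b (p n)" .
  qed
next
  have concat: "ennreal (\<Sum>i<n. dist (\<gamma> (p i)) (\<gamma> (p (Suc i))))
      + ennreal (\<Sum>i<m. dist (\<gamma> (q i)) (\<gamma> (q (Suc i)))) \<le> curve_length \<gamma> a c"
    if p: "p 0 = a" "p n = b" "\<forall>i<n. p i \<le> p (Suc i)"
      and q: "q 0 = b" "q m = c" "\<forall>i<m. q i \<le> q (Suc i)" for n m and p q :: "nat \<Rightarrow> real"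
  proof -
    define r where "r i = (if i \<le> n then p i else q (i - n))" for i
    have r_q: "r (n + i) = q i" for i
      using p q by (cases i) (auto simp: r_def)
    have r_p: "r i = p i" if "i \<le> n" for i
      using that by (simp add: r_def)
    have "r i \<le> r (Suc i)" if "i < n + m" for i
    proof (cases "i < n")
      case True
      then show ?thesis using p by (simp add: r_p)
    next
      case False
      then obtain k where "i = n + k" using le_Suc_ex not_less by blast
      then show ?thesis using that q r_q[of k] r_q[of "Suc k"] by simp
    qed
    then have "ennreal (\<Sum>i<n + m. dist (\<gamma> (r i)) (\<gamma> (r (Suc i)))) \<le> curve_length \<gamma> (r 0) (r (n + m))"
      by (rule polygon_le_curve_length)
    also have "(\<Sum>i<n + m. dist (\<gamma> (r i)) (\<gamma> (r (Suc i))))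
        = (\<Sum>i<n. dist (\<gamma> (p i)) (\<gamma> (p (Suc i)))) + (\<Sum>i<m. dist (\<gamma> (q i)) (\<gamma> (q (Suc i))))"
    proof -
      have "(\<Sum>i<n + k. dist (\<gamma> (r i)) (\<gamma> (r (Suc i))))
        = (\<Sum>i<n. dist (\<gamma> (p i)) (\<gamma> (p (Suc i)))) + (\<Sum>i<k. dist (\<gamma> (q i)) (\<gamma> (q (Suc i))))" for k
        by (induction k) (use r_q r_q[of "Suc _"] in \<open>simp_all add: r_p\<close>)
      then show ?thesis .
    qed
    finally show ?thesis
      using p q by (simp add: r_p r_q sum_nonneg)
  qed
  have nonempty: "{ennreal (\<Sum>i<n. dist (\<gamma> (p i)) (\<gamma> (p (Suc i)))) | (n::nat) (p::nat \<Rightarrow> real).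
            p 0 = u \<and> p n = v \<and> (\<forall>i<n. p i \<le> p (Suc i))} \<noteq> {}" if "u \<le> v" for u v
    using that by (auto intro!: exI[of _ 1] exI[of _ "\<lambda>i. if i = 0 then u else v"])
  show "curve_length \<gamma> a b + curve_length \<gamma> b c \<le> curve_length \<gamma> a c"
    unfolding curve_length_def[of _ a b] curve_length_def[of _ b c]
    by (rule ennreal_Sup_add_Sup_le[OF nonempty nonempty]) (use assms concat in blast)+
qed

lemma curve_length_mono:
  assumes "a \<le> c" "c \<le> d" "d \<le> b"
  shows "curve_length \<gamma> c d \<le> curve_length \<gamma> a b"
proof -
  have "curve_length \<gamma> a b = curve_length \<gamma> a c + (curve_length \<gamma> c d + curve_length \<gamma> d b)"
    using assms by (simp add: curve_length_add[of a c b] curve_length_add[of c d b])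
  also have "\<dots> \<ge> curve_length \<gamma> c d"
    by (simp add: add_increasing add_increasing2)
  finally show ?thesis .
qed

text \<open>
  Length is lower semicontinuous in the end points: a fixed partition, clipped to the moving
  interval, yields a polygon whose length depends continuously on the end points.
\<close>

lemma curve_length_lsc:
  fixes \<gamma> :: "real \<Rightarrow> 'a::metric_space"
  assumes cont: "continuous_on {a..b} \<gamma>" "continuous_on {a..b} c" "continuous_on {a..b} d"
    and le: "\<And>t. t \<in> {a..b} \<Longrightarrow> a \<le> c t \<and> c t \<le> d t \<and> d t \<le> b"
    and t0: "t0 \<in> {a..b}"
    and y: "y < curve_length \<gamma> (c t0) (d t0)"
  shows "eventually (\<lambda>t. y < curve_length \<gamma> (c t) (d t)) (at t0 within {a..b})"
proof -
  from y obtain n p where p: "p 0 = c t0" "p n = d t0" "\<forall>i<n. p i \<le> p (Suc i)"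
    and y_less: "y < ennreal (\<Sum>i<n. dist (\<gamma> (p i)) (\<gamma> (p (Suc i))))"
    unfolding curve_length_def less_Sup_iff by blast
  define q where "q t i = max (c t) (min (p i) (d t))" for t i
  have up: "c t0 \<le> p i" if "i \<le> n" for i
    using that by (induction i) (use p in \<open>auto intro: order_trans\<close>)
  have down: "p i \<le> d t0" if "i \<le> n" for i
    using that by (induction rule: inc_induct) (use p in \<open>auto intro: order_trans\<close>)
  have q_t0: "q t0 i = p i" if "i \<le> n" for i
    using up[OF that] down[OF that] by (simp add: q_def)
  define S where "S t = (\<Sum>i<n. dist (\<gamma> (q t i)) (\<gamma> (q t (Suc i))))" for t
  have q_mem: "q t i \<in> {c t..d t}" if "t \<in> {a..b}" for t i
    using le[OF that] by (auto simp: q_def)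
  have cont_q: "continuous_on {a..b} (\<lambda>t. \<gamma> (q t i))" for i
  proof (rule continuous_on_compose2[OF cont(1)])
    show "continuous_on {a..b} (\<lambda>t. q t i)"
      unfolding q_def by (intro continuous_intros cont)
    show "(\<lambda>t. q t i) ` {a..b} \<subseteq> {a..b}"
    proof (rule image_subsetI)
      fix t assume "t \<in> {a..b}"
      then show "q t i \<in> {a..b}" using q_mem[of t i] le[of t] by auto
    qed
  qed
  have "continuous_on {a..b} (\<lambda>t. ennreal (S t))"
    unfolding S_def by (intro continuous_on_ennreal continuous_intros cont_q)
  then have "((\<lambda>t. ennreal (S t)) \<longlongrightarrow> ennreal (S t0)) (at t0 within {a..b})"
    using t0 by (simp add: continuous_on_def)
  moreover have "y < ennreal (S t0)"
    using y_less by (simp add: S_def q_t0)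
  ultimately have "eventually (\<lambda>t. y < ennreal (S t)) (at t0 within {a..b})"
    by (rule order_tendstoD)
  moreover have "ennreal (S t) \<le> curve_length \<gamma> (c t) (d t)" if t: "t \<in> {a..b}" for t
  proof -
    have mono: "q t i \<le> q t (Suc i)" if "i < n" for i
      using p(3) that unfolding q_def by (intro max.mono min.mono) auto
    have "ennreal (S t) \<le> curve_length \<gamma> (q t 0) (q t n)"
      unfolding S_def by (rule polygon_le_curve_length) (rule mono)
    also have "\<dots> \<le> curve_length \<gamma> (c t) (d t)"
    proof (rule curve_length_mono)
      have "q t 0 \<le> q t i" if "i \<le> n" for i
        using that by (induction i) (use mono in \<open>auto intro: order_trans\<close>)
      then show "q t 0 \<le> q t n" by simp
    qed (use q_mem[OF t] in auto)
    finally show ?thesis .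
  qed
  ultimately show ?thesis
    by (auto simp: eventually_at_filter elim!: eventually_mono intro: less_le_trans)
qed

text \<open>
  The lengths of the parts before and after \<open>t\<close> are both lower semicontinuous in \<open>t\<close>, and their sum
  is a finite constant. Hence each of them is also upper semicontinuous.
\<close>

lemma continuous_on_curve_length:
  fixes \<gamma> :: "real \<Rightarrow> 'a::metric_space"
  assumes cont: "continuous_on {a..b} \<gamma>" and finite: "curve_length \<gamma> a b < \<infinity>"
  shows "continuous_on {a..b} (\<lambda>t. enn2real (curve_length \<gamma> a t))"
  unfolding continuous_on_def
proof
  fix t0 assume t0: "t0 \<in> {a..b}"
  define l r where "l t = enn2real (curve_length \<gamma> a t)"
    and "r t = enn2real (curve_length \<gamma> t b)" for t
  have fin: "curve_length \<gamma> c d < \<infinity>" if "a \<le> c" "c \<le> d" "d \<le> b" for c d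
    using curve_length_mono[OF that] finite by (rule le_less_trans)
  have l: "curve_length \<gamma> a t = ennreal (l t)" and r: "curve_length \<gamma> t b = ennreal (r t)"
    if "t \<in> {a..b}" for t
    using fin[of a t] fin[of t b] that by (simp_all add: l_def r_def)
  have nonneg: "0 \<le> l t" "0 \<le> r t" for t
    by (simp_all add: l_def r_def)
  have lr: "l t + r t = l t0 + r t0" if t: "t \<in> {a..b}" for t
  proof -
    have "ennreal (l t) + ennreal (r t) = ennreal (l t0) + ennreal (r t0)"
      using curve_length_add[of a t b \<gamma>] curve_length_add[of a t0 b \<gamma>] t t0
      by (simp add: l r)
    then show ?thesis by (simp add: nonneg flip: ennreal_plus)
  qed
  have lower: "eventually (\<lambda>t. y < f t) (at t0 within {a..b})"
    if lsc: "\<And>y. y < g t0 \<Longrightarrow> eventually (\<lambda>t. y < g t) (at t0 within {a..b})"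
      and g: "\<And>t. t \<in> {a..b} \<Longrightarrow> g t = ennreal (f t)" "\<And>t. 0 \<le> f t"
      and y: "y < f t0" for f :: "real \<Rightarrow> real" and g y
  proof (cases "y < 0")
    case True
    then show ?thesis using g(2) by (auto intro: always_eventually less_le_trans)
  next
    case False
    then have "eventually (\<lambda>t. ennreal y < g t) (at t0 within {a..b})"
      using y t0 by (intro lsc) (simp add: g ennreal_lessI)
    then show ?thesis
      using g(1) False by (auto simp: eventually_at_filter ennreal_less_iff elim!: eventually_mono)
  qed
  have l_lower: "eventually (\<lambda>t. y < l t) (at t0 within {a..b})" if "y < l t0" for y
    by (rule lower[OF curve_length_lsc[OF cont, of "\<lambda>_. a" "\<lambda>t. t"]])
      (use that t0 l nonneg in \<open>auto intro: continuous_intros\<close>)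
  have r_lower: "eventually (\<lambda>t. y < r t) (at t0 within {a..b})" if "y < r t0" for y
    by (rule lower[OF curve_length_lsc[OF cont, of "\<lambda>t. t" "\<lambda>_. b"]])
      (use that t0 r nonneg in \<open>auto intro: continuous_intros\<close>)
  show "((\<lambda>t. enn2real (curve_length \<gamma> a t)) \<longlongrightarrow> enn2real (curve_length \<gamma> a t0)) (at t0 within {a..b})"
    unfolding l_def[symmetric]
  proof (rule order_tendstoI[OF l_lower])
    fix y assume "l t0 < y"
    then have "eventually (\<lambda>t. l t0 + r t0 - y < r t) (at t0 within {a..b})"
      by (intro r_lower) simp
    then show "eventually (\<lambda>t. l t < y) (at t0 within {a..b})"
      unfolding eventually_at_filter
    proof (rule eventually_mono)
      fix t assume "t \<noteq> t0 \<longrightarrow> t \<in> {a..b} \<longrightarrow> l t0 + r t0 - y < r t"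
      then show "t \<noteq> t0 \<longrightarrow> t \<in> {a..b} \<longrightarrow> l t < y"
        using lr[of t] by auto
    qed
  qed
qed

section \<open>Parametrizations of arcs\<close>

lemma holder_on_imp_continuous_on:
  assumes "holder_on \<alpha> X f" "\<alpha> > 0"
  shows "continuous_on X f"
  unfolding continuous_on_iff
proof (intro ballI allI impI)
  fix x and e :: real assume x: "x \<in> X" and e: "e > 0"
  from assms(1) obtain C where C: "C > 0" "\<forall>x\<in>X. \<forall>y\<in>X. dist (f x) (f y) \<le> C * dist x y powr \<alpha>"
    unfolding holder_on_def by blast
  have "dist (f y) (f x) < e" if y: "y \<in> X" "dist y x < (e / C) powr (1 / \<alpha>)" for y
  proof -
    have "dist y x powr \<alpha> < ((e / C) powr (1 / \<alpha>)) powr \<alpha>"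
      using y assms(2) by (intro powr_less_mono2) auto
    also have "\<dots> = e / C" using assms(2) C(1) e by (simp add: powr_powr)
    finally have "C * dist y x powr \<alpha> < e" using C(1) by (simp add: field_simps)
    with C(2) x y(1) show ?thesis by (meson le_less_trans)
  qed
  then show "\<exists>d>0. \<forall>y\<in>X. dist y x < d \<longrightarrow> dist (f y) (f x) < e"
    using C(1) e by (intro exI[of _ "(e / C) powr (1 / \<alpha>)"]) auto
qed

text \<open>
  A curve on a half-line together with its limit point at infinity is a Hoelder arc as soon as there
  is a bounded, strictly increasing, continuous clock \<open>\<tau>\<close> with respect to which the curve is Hoelder.
  The Hoelder parametrization runs along the inverse of \<open>\<tau>\<close>; the estimate extends to the limit point
  by passing to the limit. Continuity of \<open>\<tau>\<close> enters only to make its values fill the interval up to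
  the supremum, and continuity of the inverse homeomorphism comes from compactness.
\<close>

lemma holder_arc_of_ray:
  fixes \<gamma> :: "real \<Rightarrow> 'a::metric_space"
  assumes inj: "inj_on \<gamma> {a..}" and lim: "(\<gamma> \<longlongrightarrow> z) at_top" and z: "z \<notin> \<gamma> ` {a..}"
    and cont: "continuous_on {a..} \<tau>" and mono: "strict_mono_on {a..} \<tau>"
    and start: "\<tau> a = 0" and bdd: "bdd_above (\<tau> ` {a..})"
    and "K > 0" "\<alpha> > 0"
    and bound: "\<And>t u. a \<le> t \<Longrightarrow> t \<le> u \<Longrightarrow> dist (\<gamma> t) (\<gamma> u) \<le> K * (\<tau> u - \<tau> t) powr \<alpha>"
  shows "holder_arc \<alpha> (\<gamma> ` {a..} \<union> {z})"
proof -
  define T where "T = Sup (\<tau> ` {a..})"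
  have le_T: "\<tau> t \<le> T" if "t \<ge> a" for t
    unfolding T_def using that bdd by (intro cSup_upper) auto
  have less_T: "\<tau> t < T" if "t \<ge> a" for t
    using strict_mono_onD[OF mono, of t "t + 1"] le_T[of "t + 1"] that by simp
  have T_pos: "T > 0" using less_T[of a] start by simp
  have surj: "\<exists>t\<ge>a. \<tau> t = x" if x: "0 \<le> x" "x < T" for x
  proof -
    obtain u where u: "u \<ge> a" "x < \<tau> u"
      using x(2) bdd unfolding T_def by (subst (asm) less_cSup_iff) auto
    have "continuous_on {a..u} \<tau>" using cont by (rule continuous_on_subset) auto
    then show ?thesis using IVT'[of \<tau> a x u] u x(1) start by auto
  qed
  then obtain \<sigma> where \<sigma>: "\<And>x. 0 \<le> x \<Longrightarrow> x < T \<Longrightarrow> \<sigma> x \<ge> a \<and> \<tau> (\<sigma> x) = x"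
    by metis
  have \<tau>_inj: "t = u" if "t \<ge> a" "u \<ge> a" "\<tau> t = \<tau> u" for t u
    using strict_mono_on_imp_inj_on[OF mono] that by (auto simp: inj_on_def)
  have \<tau>_nonneg: "0 \<le> \<tau> t" if "t \<ge> a" for t
    using strict_mono_onD[OF mono, of a t] that start by (cases "t = a") auto
  have tail: "dist (\<gamma> t) z \<le> K * (T - \<tau> t) powr \<alpha>" if t: "t \<ge> a" for t
  proof (rule tendsto_upperbound)
    show "((\<lambda>u. dist (\<gamma> t) (\<gamma> u)) \<longlongrightarrow> dist (\<gamma> t) z) at_top"
      by (intro tendsto_intros lim)
    show "eventually (\<lambda>u. dist (\<gamma> t) (\<gamma> u) \<le> K * (T - \<tau> t) powr \<alpha>) at_top"
      using eventually_ge_at_top[of t]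
    proof eventually_elim
      fix u assume u: "t \<le> u"
      have "\<tau> t \<le> \<tau> u" using strict_mono_on_leD[OF mono] t u by auto
      then have "(\<tau> u - \<tau> t) powr \<alpha> \<le> (T - \<tau> t) powr \<alpha>"
        using le_T[of u] t u \<open>\<alpha> > 0\<close> by (intro powr_mono2) auto
      then show "dist (\<gamma> t) (\<gamma> u) \<le> K * (T - \<tau> t) powr \<alpha>"
        using bound[OF t u] \<open>K > 0\<close> by (meson mult_left_mono less_imp_le order_trans)
    qed
  qed simp
  define f where "f x = (if x < 1 then \<gamma> (\<sigma> (T * x)) else z)" for x :: real
  have scaled: "\<sigma> (T * x) \<ge> a" "\<tau> (\<sigma> (T * x)) = T * x" if "0 \<le> x" "x < 1" for x
    using \<sigma>[of "T * x"] that T_pos by simp_all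
  have step: "dist (f x) (f y) \<le> K * T powr \<alpha> * \<bar>x - y\<bar> powr \<alpha>"
    if xy: "0 \<le> x" "x < y" "y \<le> 1" for x y
  proof -
    have "dist (f x) (f y) \<le> K * (T * y - T * x) powr \<alpha>"
    proof (cases "y = 1")
      case True
      then show ?thesis using tail[of "\<sigma> (T * x)"] scaled[of x] xy by (simp add: f_def)
    next
      case False
      have "\<not> \<sigma> (T * y) < \<sigma> (T * x)"
      proof
        assume "\<sigma> (T * y) < \<sigma> (T * x)"
        then have "T * y < T * x"
          using strict_mono_onD[OF mono, of "\<sigma> (T * y)" "\<sigma> (T * x)"] scaled[of x] scaled[of y] xy False
          by simp
        then show False using xy T_pos by simp
      qed
      then show ?thesis
        using bound[of "\<sigma> (T * x)" "\<sigma> (T * y)"] scaled[of x] scaled[of y] xy False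
        by (simp add: f_def)
    qed
    also have "T * y - T * x = T * \<bar>x - y\<bar>" using xy by (simp add: algebra_simps)
    finally show ?thesis using T_pos by (simp add: powr_mult mult.assoc)
  qed
  have holder: "holder_on \<alpha> {0..1} f"
    unfolding holder_on_def
  proof (intro exI[of _ "K * T powr \<alpha>"] conjI ballI)
    fix x y :: real assume "x \<in> {0..1}" "y \<in> {0..1}"
    then show "dist (f x) (f y) \<le> K * T powr \<alpha> * dist x y powr \<alpha>"
      using step[of x y] step[of y x]
      by (cases x y rule: linorder_cases) (simp_all add: dist_real_def dist_commute abs_minus_commute)
  qed (use T_pos \<open>K > 0\<close> in simp)
  have image: "f ` {0..1} = \<gamma> ` {a..} \<union> {z}"
  proof (intro equalityI subsetI)
    fix w assume "w \<in> f ` {0..1}"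
    then show "w \<in> \<gamma> ` {a..} \<union> {z}" using scaled by (auto simp: f_def)
  next
    fix w assume "w \<in> \<gamma> ` {a..} \<union> {z}"
    then consider t where "t \<ge> a" "w = \<gamma> t" | "w = z" by auto
    then show "w \<in> f ` {0..1}"
    proof cases
      case (1 t)
      define x where "x = \<tau> t / T"
      have x: "0 \<le> x" "x < 1" "T * x = \<tau> t"
        using \<tau>_nonneg less_T 1(1) T_pos by (simp_all add: x_def)
      have "\<sigma> (T * x) = t" using scaled[OF x(1,2)] x(3) \<tau>_inj 1(1) by simp
      then have "f x = w" using x 1 by (simp add: f_def)
      then show ?thesis using x by force
    next
      case 2
      then show ?thesis by (intro image_eqI[of _ _ 1]) (simp_all add: f_def)
    qed
  qed
  have "inj_on f {0..1}"
  proof (rule inj_onI)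
    fix x y :: real assume xy: "x \<in> {0..1}" "y \<in> {0..1}" and eq: "f x = f y"
    have iff: "x < 1 \<longleftrightarrow> y < 1"
      using eq z scaled xy by (auto simp: f_def split: if_splits)
    show "x = y"
    proof (cases "x < 1")
      case True
      then have "\<gamma> (\<sigma> (T * x)) = \<gamma> (\<sigma> (T * y))"
        using eq iff by (simp add: f_def)
      then have "\<sigma> (T * x) = \<sigma> (T * y)"
        using scaled(1)[of x] scaled(1)[of y] True iff xy by (intro inj_onD[OF inj]) auto
      then have "T * x = T * y"
        using scaled(2)[of x] scaled(2)[of y] True iff xy by (metis atLeastAtMost_iff)
      then show ?thesis using T_pos by simp
    next
      case False
      then show ?thesis using iff xy by simp
    qed
  qed
  then obtain g where "homeomorphism {0..1} (\<gamma> ` {a..} \<union> {z}) f g"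
    using homeomorphism_compact[OF compact_Icc holder_on_imp_continuous_on[OF holder \<open>\<alpha> > 0\<close>] image]
    by blast
  with holder show ?thesis unfolding holder_arc_def by blast
qed

section \<open>Turns of a spiral arc\<close>

lemma norm_spiral_curve: "0 \<le> \<phi> t \<Longrightarrow> norm (spiral_curve \<phi> t) = \<phi> t"
  by (simp add: spiral_curve_def norm_mult)

lemma spiral_curve_add_2pi:
  "spiral_curve \<phi> (t + 2 * pi) = of_real (\<phi> (t + 2 * pi)) * exp (\<i> * of_real t)"
  using exp_plus_2pin[of "\<i> * of_real t" 1] by (simp add: spiral_curve_def algebra_simps)

lemma spiral_curve_add_pi:
  "spiral_curve \<phi> (t + pi) = - (of_real (\<phi> (t + pi)) * exp (\<i> * of_real t))"
  by (simp add: spiral_curve_def distrib_left exp_add)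

locale positive_spiral_arc =
  fixes \<phi> :: "real \<Rightarrow> real"
  assumes cont: "continuous_on {2 * pi..} \<phi>"
    and pos: "\<And>t. t \<ge> 2 * pi \<Longrightarrow> \<phi> t > 0"
    and lim: "(\<phi> \<longlongrightarrow> 0) at_top"
    and arc: "spiral_arc \<phi>"
begin

lemma continuous_spiral_curve: "continuous_on {2 * pi..} (spiral_curve \<phi>)"
  unfolding spiral_curve_def by (intro continuous_intros cont)

lemma spiral_curve_inject:
  "t \<ge> 2 * pi \<Longrightarrow> u \<ge> 2 * pi \<Longrightarrow> spiral_curve \<phi> t = spiral_curve \<phi> u \<longleftrightarrow> t = u"
  using arc by (auto simp: spiral_arc_def inj_on_def)

lemma spiral_curve_nonzero: "t \<ge> 2 * pi \<Longrightarrow> spiral_curve \<phi> t \<noteq> 0"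
  using pos[of t] by (simp add: spiral_curve_def)

lemma dist_spiral_curve_le:
  assumes "t \<ge> 2 * pi" "u \<ge> 2 * pi"
  shows "dist (spiral_curve \<phi> t) (spiral_curve \<phi> u) \<le> \<phi> t + \<phi> u"
  using norm_triangle_ineq4[of "spiral_curve \<phi> t" "spiral_curve \<phi> u"] assms pos[of t] pos[of u]
  by (simp add: norm_spiral_curve dist_norm)

text \<open>
  Equality of the radii at \<open>t\<close> and \<open>t + 2\<pi>\<close> would be a self-intersection, so the sign of the
  difference is constant along the spiral. If the radius grew from turn to turn, it could not tend
  to \<open>0\<close>.
\<close>

lemma radius_decreases:
  assumes "t \<ge> 2 * pi"
  shows "\<phi> (t + 2 * pi) < \<phi> t"
proof (rule ccontr)
  assume not_less: "\<not> \<phi> (t + 2 * pi) < \<phi> t"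
  define D where "D u = \<phi> (u + 2 * pi) - \<phi> u" for u
  have D_nonzero: "D u \<noteq> 0" if "u \<ge> 2 * pi" for u
  proof
    assume "D u = 0"
    then have "spiral_curve \<phi> (u + 2 * pi) = spiral_curve \<phi> u"
      by (simp add: spiral_curve_add_2pi D_def) (simp add: spiral_curve_def)
    then show False
      using spiral_curve_inject[of "u + 2 * pi" u] that pi_gt_zero by linarith
  qed
  have "continuous_on {2 * pi..} D"
    unfolding D_def
    by (intro continuous_intros cont continuous_on_compose2[OF cont]) (auto intro: add_increasing2)
  then have "connected (D ` {2 * pi..})"
    by (intro connected_continuous_image) auto
  moreover have "D t > 0"
    using not_less D_nonzero[OF assms] by (simp add: D_def)
  ultimately have D_pos: "D u > 0" if "u \<ge> 2 * pi" for u
    using connectedD_interval[of "D ` {2 * pi..}" "D u" "D t" 0] D_nonzero that assms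
    by (force simp: not_less)
  have grows: "\<phi> t \<le> \<phi> (t + 2 * pi * real k)" for k
  proof (induction k)
    case (Suc k)
    have "0 < D (t + 2 * pi * real k)"
      using assms by (intro D_pos) (simp add: add_increasing2)
    with Suc show ?case by (simp add: D_def algebra_simps)
  qed simp
  have "filterlim (\<lambda>k. t + 2 * pi * real k) at_top sequentially"
    by (intro filterlim_tendsto_add_at_top[OF tendsto_const]
        filterlim_tendsto_pos_mult_at_top[OF tendsto_const] filterlim_real_sequentially) simp
  then have "(\<lambda>k. \<phi> (t + 2 * pi * real k)) \<longlonglongrightarrow> 0"
    by (rule filterlim_compose[OF lim])
  then have "\<phi> t \<le> 0"
    by (rule tendsto_lowerbound) (simp_all add: grows)
  with pos[OF assms] show False by simp
qed

lemma turn_interval_ge: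
  assumes "j \<ge> 1" "t \<in> turn_interval j"
  shows "t \<ge> 2 * pi"
proof -
  have "2 * pi * 1 \<le> 2 * pi * real j"
    using assms(1) by (intro mult_left_mono) auto
  also have "\<dots> \<le> t" using assms(2) by (simp add: turn_interval_def)
  finally show ?thesis by simp
qed

text \<open>Unwinding \<open>t\<close> back to the \<open>j\<close>-th turn by multiples of \<open>2\<pi>\<close> increases the radius.\<close>

lemma radius_le_turn_max:
  assumes j: "j \<ge> 1" and t: "t \<ge> 2 * pi * real j"
  shows "\<phi> t \<le> turn_max \<phi> j"
proof -
  define k where "k = nat \<lfloor>(t - 2 * pi * real j) / (2 * pi)\<rfloor>"
  define u where "u = t - 2 * pi * real k"
  have "real k \<le> (t - 2 * pi * real j) / (2 * pi)" "(t - 2 * pi * real j) / (2 * pi) < real k + 1"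
    using t by (auto simp: k_def intro: real_of_int_floor_add_one_gt)
  then have u: "u \<in> turn_interval j"
    by (simp add: u_def turn_interval_def field_simps)
  have "\<phi> (u + 2 * pi * real i) \<le> \<phi> u" for i
  proof (induction i)
    case (Suc i)
    have "\<phi> (u + 2 * pi * real i + 2 * pi) < \<phi> (u + 2 * pi * real i)"
      using turn_interval_ge[OF j u] by (intro radius_decreases) (simp add: add_increasing2)
    with Suc show ?case by (simp add: algebra_simps)
  qed simp
  from this[of k] have "\<phi> t \<le> \<phi> u" by (simp add: u_def)
  also have "\<phi> u \<le> turn_max \<phi> j"
    using turn_max_attained[OF cont j] u by force
  finally show ?thesis .
qed

lemma turn_max_pos:
  assumes "j \<ge> 1"
  shows "turn_max \<phi> j > 0"
proof -
  obtain t where "t \<in> turn_interval j" "\<phi> t = turn_max \<phi> j"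
    using turn_max_attained[OF cont assms] by blast
  then show ?thesis using pos[OF turn_interval_ge[OF assms]] by metis
qed

text \<open>
  From a point of maximal radius, half a turn forwards or backwards stays within the same turn and
  leads to the opposite side of the origin.
\<close>

lemma turn_max_le_diameter:
  assumes "j \<ge> 1"
  obtains t u where "t \<in> turn_interval j" "u \<in> turn_interval j" "t \<le> u"
    "turn_max \<phi> j \<le> dist (spiral_curve \<phi> t) (spiral_curve \<phi> u)"
proof -
  have antipodal: "dist (spiral_curve \<phi> t) (spiral_curve \<phi> (t + pi)) = \<phi> t + \<phi> (t + pi)"
    if "t \<ge> 2 * pi" for t
  proof -
    have "dist (spiral_curve \<phi> t) (spiral_curve \<phi> (t + pi))
        = norm (of_real (\<phi> t + \<phi> (t + pi)) * exp (\<i> * of_real t))"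
      unfolding spiral_curve_add_pi dist_norm
      by (simp add: spiral_curve_def algebra_simps)
    also have "\<dots> = \<phi> t + \<phi> (t + pi)"
      using pos[of t] pos[of "t + pi"] that pi_gt_zero
      by (simp add: norm_mult del: of_real_add pi_gt_zero)
    finally show ?thesis .
  qed
  obtain t where t: "t \<in> turn_interval j" "\<phi> t = turn_max \<phi> j"
    using turn_max_attained[OF cont assms] by blast
  note t_ge = turn_interval_ge[OF assms t(1)]
  show thesis
  proof (cases "t + pi \<in> turn_interval j")
    case True
    then show thesis
      using that[of t "t + pi"] t antipodal[OF t_ge] pos[of "t + pi"]
        turn_interval_ge[OF assms True] by simp
  next
    case False
    then have "t - pi \<in> turn_interval j"
      using t(1) by (auto simp: turn_interval_def algebra_simps)
    moreover from this have "t - pi \<ge> 2 * pi" by (rule turn_interval_ge[OF assms])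
    ultimately show thesis
      using that[of "t - pi" t] t antipodal[of "t - pi"] pos[of "t - pi"] by simp
  qed
qed

section \<open>Hoelder arcs give convergent series\<close>

text \<open>
  A Hoelder parametrization spends time at least of order \<open>\<phi>\<^sub>j\<^sup>s\<close> on the \<open>j\<close>-th turn, which has
  diameter at least \<open>\<phi>\<^sub>j\<close>, and the total time is \<open>1\<close>.
\<close>

lemma summable_of_holder_arc:
  assumes "s > 0" and "holder_arc (1 / s) (spiral \<phi>)"
  shows "summable (\<lambda>n. turn_max \<phi> (Suc n) powr s)"
proof -
  from assms(2) obtain f g where hom: "homeomorphism {0..1::real} (spiral \<phi>) f g"
    and "holder_on (1 / s) {0..1} f"
    unfolding holder_arc_def by blast
  then obtain C where "C > 0" and holder: "\<forall>x\<in>{0..1}. \<forall>y\<in>{0..1}. dist (f x) (f y) \<le> C * dist x y powr (1 / s)"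
    unfolding holder_on_def by blast
  define h where "h t = g (spiral_curve \<phi> t)" for t
  have mem: "spiral_curve \<phi> t \<in> spiral \<phi>" if "t \<ge> 2 * pi" for t
    using that by (auto simp: spiral_def)
  have h_mem: "h t \<in> {0..1}" and f_h: "f (h t) = spiral_curve \<phi> t" if "t \<ge> 2 * pi" for t
    using hom mem[OF that] by (auto simp: homeomorphism_def h_def)
  have h_cont: "continuous_on {2 * pi..} h"
    unfolding h_def using hom mem
    by (intro continuous_on_compose2[OF _ continuous_spiral_curve, of "spiral \<phi>" g])
      (auto simp: homeomorphism_def)
  have h_inj: "inj_on h {2 * pi..}"
    using f_h spiral_curve_inject by (intro inj_onI) (metis atLeast_iff)
  \<comment> \<open>Monotonicity of \<open>h\<close>, in a form that does not depend on its direction.\<close>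
  have h_add: "\<bar>h t - h v\<bar> = \<bar>h t - h u\<bar> + \<bar>h u - h v\<bar>" if "2 * pi \<le> t" "t \<le> u" "u \<le> v" for t u v
  proof (cases "t = u \<or> u = v")
    case False
    have "continuous_on {t..v} h" "inj_on h {t..v}"
      using that by (auto intro: continuous_on_subset[OF h_cont] inj_on_subset[OF h_inj])
    with continuous_inj_imp_mono[of t u v h] False that show ?thesis by auto
  qed auto
  define p where "p n = 2 * pi * real (Suc n)" for n
  have p_ge: "2 * pi \<le> p n" and p_le: "p n \<le> p (Suc n)" for n
    by (simp_all add: p_def algebra_simps)
  have p_mono: "p 0 \<le> p n" for n
    by (simp add: p_def)
  define L where "L n = \<bar>h (p n) - h (p (Suc n))\<bar>" for n
  have length_ge: "turn_max \<phi> (Suc n) powr s \<le> C powr s * L n" for n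
  proof -
    obtain t u where tu: "t \<in> turn_interval (Suc n)" "u \<in> turn_interval (Suc n)" "t \<le> u"
      and diam: "turn_max \<phi> (Suc n) \<le> dist (spiral_curve \<phi> t) (spiral_curve \<phi> u)"
      using turn_max_le_diameter[of "Suc n"] by auto
    have between: "p n \<le> t" "u \<le> p (Suc n)"
      using tu by (simp_all add: turn_interval_def p_def algebra_simps)
    have ge: "t \<ge> 2 * pi" "u \<ge> 2 * pi"
      using tu turn_interval_ge[of "Suc n"] by auto
    have "L n = \<bar>h (p n) - h t\<bar> + (\<bar>h t - h u\<bar> + \<bar>h u - h (p (Suc n))\<bar>)"
      using h_add[of "p n" t "p (Suc n)"] h_add[of t u "p (Suc n)"] between tu(3) p_ge[of n] ge
      by (simp add: L_def)
    then have hL: "\<bar>h t - h u\<bar> \<le> L n" by simp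
    note diam
    also have "dist (spiral_curve \<phi> t) (spiral_curve \<phi> u) \<le> C * \<bar>h t - h u\<bar> powr (1 / s)"
      using holder h_mem[OF ge(1)] h_mem[OF ge(2)] f_h ge by (metis dist_real_def)
    also have "\<dots> \<le> C * L n powr (1 / s)"
      using hL \<open>C > 0\<close> \<open>s > 0\<close> by (intro mult_left_mono powr_mono2) auto
    finally have "turn_max \<phi> (Suc n) powr s \<le> (C * L n powr (1 / s)) powr s"
      using turn_max_pos[of "Suc n"] \<open>s > 0\<close> by (intro powr_mono2) auto
    also have "\<dots> = C powr s * L n"
      using \<open>s > 0\<close> \<open>C > 0\<close> by (simp add: powr_mult powr_powr L_def)
    finally show ?thesis .
  qed
  have "summable L"
  proof (rule summableI_nonneg_bounded[where x = 1])
    fix n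
    have "(\<Sum>i<n. L i) = \<bar>h (p 0) - h (p n)\<bar>"
    proof (induction n)
      case (Suc n)
      then show ?case
        using h_add[OF p_ge p_mono[of n] p_le[of n]] by (simp add: L_def)
    qed simp
    also have "\<dots> \<le> 1"
      using h_mem[OF p_ge[of 0]] h_mem[OF p_ge[of n]] by auto
    finally show "(\<Sum>i<n. L i) \<le> 1" .
  qed (simp add: L_def)
  then have "summable (\<lambda>n. C powr s * L n)" by (rule summable_mult)
  then show ?thesis
    by (rule summable_comparison_test') (unfold real_norm_def abs_of_nonneg[OF powr_ge_zero], rule length_ge)
qed

end

section \<open>Convergent series give Hoelder arcs\<close>

locale summable_spiral_arc = positive_spiral_arc +
  fixes s C :: real
  assumes s: "s > 1"
    and turn_length_le: "\<And>j. j \<ge> 1 \<Longrightarrow>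
      curve_length (spiral_curve \<phi>) (2 * pi * real j) (2 * pi * (real j + 1)) \<le> ennreal (C * turn_max \<phi> j)"
    and C: "C > 0"
    and summable: "summable (\<lambda>n. turn_max \<phi> (Suc n) powr s)"
begin

definition clip :: "nat \<Rightarrow> real \<Rightarrow> real" where
  "clip j t = max (2 * pi * real j) (min t (2 * pi * (real j + 1)))"

text \<open>
  The length of the part of the \<open>j\<close>-th turn traversed up to angle \<open>t\<close>. Clipping makes it a function
  on the whole line, constant outside the turn, so that contributions of all turns can be added up.
\<close>

definition length_within :: "nat \<Rightarrow> real \<Rightarrow> real" where
  "length_within j t = enn2real (curve_length (spiral_curve \<phi>) (2 * pi * real j) (clip j t))"

text \<open>
  The new time. The weight \<open>\<phi>\<^sub>j\<^sup>s\<^sup>-\<^sup>1\<close> makes the time spent on the \<open>j\<close>-th turn comparable to \<open>\<phi>\<^sub>j\<^sup>s\<close>,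
  which up to a constant is the shortest time that a \<open>1/s\<close>-Hoelder parametrization can afford.
\<close>

definition parameter :: "real \<Rightarrow> real" where
  "parameter t = (\<Sum>n. turn_max \<phi> (Suc n) powr (s - 1) * length_within (Suc n) t)"

lemma clip_mem: "clip j t \<in> turn_interval j"
  by (simp add: clip_def turn_interval_def min_def max_def)

lemma clip_eq: "t \<in> turn_interval j \<Longrightarrow> clip j t = t"
  by (auto simp: clip_def turn_interval_def)

lemma clip_mono: "t \<le> u \<Longrightarrow> clip j t \<le> clip j u"
  unfolding clip_def by (intro max.mono min.mono) auto

lemma finite_length:
  assumes "j \<ge> 1" "t \<in> turn_interval j"
  shows "curve_length (spiral_curve \<phi>) (2 * pi * real j) t < \<infinity>"
proof -
  have "curve_length (spiral_curve \<phi>) (2 * pi * real j) t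
      \<le> curve_length (spiral_curve \<phi>) (2 * pi * real j) (2 * pi * (real j + 1))"
    using assms(2) by (intro curve_length_mono) (auto simp: turn_interval_def)
  also have "\<dots> \<le> ennreal (C * turn_max \<phi> j)" by (rule turn_length_le[OF assms(1)])
  also have "\<dots> < \<infinity>" by simp
  finally show ?thesis .
qed

lemma length_within_nonneg: "0 \<le> length_within j t"
  by (simp add: length_within_def)

lemma length_within_le:
  assumes "j \<ge> 1"
  shows "length_within j t \<le> C * turn_max \<phi> j"
proof -
  have "curve_length (spiral_curve \<phi>) (2 * pi * real j) (clip j t)
      \<le> curve_length (spiral_curve \<phi>) (2 * pi * real j) (2 * pi * (real j + 1))"
    using clip_mem[of j t] by (intro curve_length_mono) (auto simp: turn_interval_def)
  also have "\<dots> \<le> ennreal (C * turn_max \<phi> j)" by (rule turn_length_le[OF assms])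
  finally show ?thesis
    unfolding length_within_def
    using C turn_max_pos[OF assms] by (intro enn2real_leI) auto
qed

lemma dist_le_length_within:
  assumes "j \<ge> 1" "t \<le> u"
  shows "dist (spiral_curve \<phi> (clip j t)) (spiral_curve \<phi> (clip j u))
    \<le> length_within j u - length_within j t"
proof -
  let ?len = "curve_length (spiral_curve \<phi>)"
  have "ennreal (length_within j t + dist (spiral_curve \<phi> (clip j t)) (spiral_curve \<phi> (clip j u)))
      = ?len (2 * pi * real j) (clip j t) + ennreal (dist (spiral_curve \<phi> (clip j t)) (spiral_curve \<phi> (clip j u)))"
    using finite_length[OF assms(1) clip_mem] by (simp add: length_within_def ennreal_plus)
  also have "\<dots> \<le> ?len (2 * pi * real j) (clip j t) + ?len (clip j t) (clip j u)"
    using clip_mono[OF assms(2)] by (intro add_left_mono dist_le_curve_length)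
  also have "\<dots> = ?len (2 * pi * real j) (clip j u)"
    using clip_mem[of j t] clip_mono[OF assms(2)]
    by (intro curve_length_add[symmetric]) (auto simp: turn_interval_def)
  also have "\<dots> = ennreal (length_within j u)"
    using finite_length[OF assms(1) clip_mem] by (simp add: length_within_def)
  finally show ?thesis by (simp add: length_within_nonneg flip: ennreal_plus)
qed

lemma length_within_mono: "j \<ge> 1 \<Longrightarrow> t \<le> u \<Longrightarrow> length_within j t \<le> length_within j u"
  using dist_le_length_within[of j t u]
    zero_le_dist[of "spiral_curve \<phi> (clip j t)" "spiral_curve \<phi> (clip j u)"] by linarith

lemma continuous_length_within:
  assumes "j \<ge> 1"
  shows "continuous_on UNIV (length_within j)"
proof -
  have "turn_interval j \<subseteq> {2 * pi..}" using turn_interval_ge[OF assms] by auto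
  then have "continuous_on (turn_interval j) (spiral_curve \<phi>)"
    by (rule continuous_on_subset[OF continuous_spiral_curve])
  then have "continuous_on (turn_interval j)
      (\<lambda>t. enn2real (curve_length (spiral_curve \<phi>) (2 * pi * real j) t))"
    unfolding turn_interval_def
    by (rule continuous_on_curve_length)
      (rule finite_length[OF assms], simp add: turn_interval_def)
  then show ?thesis
    unfolding length_within_def
    by (rule continuous_on_compose2)
      (use clip_mem in \<open>auto simp: clip_def intro!: continuous_intros\<close>)
qed

lemma term_nonneg: "0 \<le> turn_max \<phi> (Suc n) powr (s - 1) * length_within (Suc n) t"
  by (simp add: length_within_nonneg)

lemma term_le: "turn_max \<phi> (Suc n) powr (s - 1) * length_within (Suc n) t \<le> C * turn_max \<phi> (Suc n) powr s"
proof -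
  have "turn_max \<phi> (Suc n) powr s = turn_max \<phi> (Suc n) powr (s - 1) * turn_max \<phi> (Suc n)"
    using turn_max_pos[of "Suc n"] by (simp add: powr_diff)
  then show ?thesis
    using mult_left_mono[OF length_within_le[of "Suc n" t], of "turn_max \<phi> (Suc n) powr (s - 1)"]
    by (simp add: algebra_simps)
qed

lemma summable_terms: "summable (\<lambda>n. turn_max \<phi> (Suc n) powr (s - 1) * length_within (Suc n) t)"
  by (rule summable_comparison_test'[OF summable_mult[OF summable, of C]])
    (use term_nonneg term_le in auto)

lemma parameter_le: "parameter t \<le> (\<Sum>n. C * turn_max \<phi> (Suc n) powr s)"
  unfolding parameter_def
  by (intro suminf_le summable_terms summable_mult summable term_le)

text \<open>The series converges uniformly, by the Weierstrass test with majorant \<open>C \<phi>\<^sub>j\<^sup>s\<close>.\<close>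

lemma continuous_parameter: "continuous_on UNIV parameter"
  unfolding parameter_def
proof (rule uniform_limit_theorem)
  show "uniform_limit UNIV
      (\<lambda>N t. \<Sum>n<N. turn_max \<phi> (Suc n) powr (s - 1) * length_within (Suc n) t)
      (\<lambda>t. \<Sum>n. turn_max \<phi> (Suc n) powr (s - 1) * length_within (Suc n) t) sequentially"
    by (rule Weierstrass_m_test[OF _ summable_mult[OF summable, of C]])
      (use term_nonneg term_le in auto)
  show "\<forall>\<^sub>F N in sequentially. continuous_on UNIV
      (\<lambda>t. \<Sum>n<N. turn_max \<phi> (Suc n) powr (s - 1) * length_within (Suc n) t)"
    by (intro always_eventually allI continuous_intros continuous_length_within) auto
qed simp

lemma parameter_start: "parameter (2 * pi) = 0"
proof -
  have "length_within (Suc n) (2 * pi) = 0" for n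
  proof -
    have "2 * pi * 1 \<le> 2 * pi * real (Suc n)" by (intro mult_left_mono) auto
    then have "clip (Suc n) (2 * pi) = 2 * pi * real (Suc n)"
      by (simp add: clip_def max_def min_def)
    then show ?thesis by (simp add: length_within_def curve_length_refl)
  qed
  then show ?thesis by (simp add: parameter_def)
qed

lemma turn_growth_le_parameter:
  assumes "j \<ge> 1" "t \<le> u"
  shows "turn_max \<phi> j powr (s - 1) * (length_within j u - length_within j t) \<le> parameter u - parameter t"
proof -
  let ?d = "\<lambda>n. turn_max \<phi> (Suc n) powr (s - 1) * length_within (Suc n) u
              - turn_max \<phi> (Suc n) powr (s - 1) * length_within (Suc n) t"
  have "0 \<le> ?d n" for n
    using length_within_mono[of "Suc n" t u] assms(2) by (simp add: mult_left_mono)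
  moreover have "summable ?d" by (intro summable_diff summable_terms)
  ultimately have "(\<Sum>n\<in>{j - 1}. ?d n) \<le> suminf ?d"
    by (intro sum_le_suminf) auto
  also have "suminf ?d = parameter u - parameter t"
    unfolding parameter_def by (intro suminf_diff[symmetric] summable_terms)
  finally show ?thesis using assms(1) by (simp add: right_diff_distrib)
qed

lemma parameter_mono: "t \<le> u \<Longrightarrow> parameter t \<le> parameter u"
  unfolding parameter_def
  by (intro suminf_le summable_terms mult_left_mono length_within_mono) auto

lemma dist_le_parameter_in_turn:
  assumes j: "j \<ge> 1" and tu: "t \<in> turn_interval j" "u \<in> turn_interval j" "t \<le> u"
  shows "turn_max \<phi> j powr (s - 1) * dist (spiral_curve \<phi> t) (spiral_curve \<phi> u)
    \<le> parameter u - parameter t"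
proof -
  have "turn_max \<phi> j powr (s - 1) * dist (spiral_curve \<phi> t) (spiral_curve \<phi> u)
      \<le> turn_max \<phi> j powr (s - 1) * (length_within j u - length_within j t)"
    using dist_le_length_within[OF j tu(3)] tu by (intro mult_left_mono) (simp_all add: clip_eq)
  also have "\<dots> \<le> parameter u - parameter t"
    by (rule turn_growth_le_parameter[OF j tu(3)])
  finally show ?thesis .
qed

text \<open>
  A chord \<open>d\<close> of the \<open>j\<close>-th turn satisfies \<open>d \<le> 2\<phi>\<^sub>j\<close>, so
  \<open>d\<^sup>s = d\<^sup>s\<^sup>-\<^sup>1 d \<le> 2\<^sup>s\<^sup>-\<^sup>1 \<phi>\<^sub>j\<^sup>s\<^sup>-\<^sup>1 d\<close>, and \<open>\<phi>\<^sub>j\<^sup>s\<^sup>-\<^sup>1 d\<close> is at most the time spent.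
\<close>

lemma holder_in_turn:
  assumes j: "j \<ge> 1" and tu: "t \<in> turn_interval j" "u \<in> turn_interval j" "t \<le> u"
  shows "dist (spiral_curve \<phi> t) (spiral_curve \<phi> u) \<le> 2 * (parameter u - parameter t) powr (1 / s)"
proof -
  define d M D where "d = dist (spiral_curve \<phi> t) (spiral_curve \<phi> u)" and "M = turn_max \<phi> j"
    and "D = parameter u - parameter t"
  have M: "M > 0" using turn_max_pos[OF j] by (simp add: M_def)
  have D: "M powr (s - 1) * d \<le> D"
    using dist_le_parameter_in_turn[OF assms] by (simp add: d_def M_def D_def)
  have d_le: "d \<le> 2 * M"
    using dist_spiral_curve_le[of t u] turn_interval_ge[OF j tu(1)] turn_interval_ge[OF j tu(2)]
      radius_le_turn_max[OF j, of t] radius_le_turn_max[OF j, of u] tu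
    by (simp add: d_def M_def turn_interval_def)
  have d: "d \<ge> 0" by (simp add: d_def)
  have "d powr s = d powr (s - 1) * d"
    using d by (cases "d = 0") (simp_all add: powr_diff)
  also have "\<dots> \<le> (2 * M) powr (s - 1) * d"
    using d d_le s by (intro mult_right_mono powr_mono2) auto
  also have "\<dots> = 2 powr (s - 1) * (M powr (s - 1) * d)"
    using M by (simp add: powr_mult)
  also have "\<dots> \<le> 2 powr s * D"
    using D M d s by (intro mult_mono) auto
  finally have "(d powr s) powr (1 / s) \<le> (2 powr s * D) powr (1 / s)"
    using s by (intro powr_mono2) auto
  then show ?thesis
    using d s D M by (simp add: powr_powr powr_mult d_def[symmetric] D_def[symmetric])
qed

lemma turn_max_le_parameter:
  assumes j: "j \<ge> 1"
  shows "turn_max \<phi> j \<le> 2 * (parameter (2 * pi * (real j + 1)) - parameter (2 * pi * real j)) powr (1 / s)"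
proof -
  obtain t u where tu: "t \<in> turn_interval j" "u \<in> turn_interval j" "t \<le> u"
    and "turn_max \<phi> j \<le> dist (spiral_curve \<phi> t) (spiral_curve \<phi> u)"
    using turn_max_le_diameter[OF j] .
  note this(4)
  also have "dist (spiral_curve \<phi> t) (spiral_curve \<phi> u) \<le> 2 * (parameter u - parameter t) powr (1 / s)"
    by (rule holder_in_turn[OF j tu])
  also have "\<dots> \<le> 2 * (parameter (2 * pi * (real j + 1)) - parameter (2 * pi * real j)) powr (1 / s)"
    using parameter_mono[of t u] parameter_mono[of "2 * pi * real j" t]
      parameter_mono[of u "2 * pi * (real j + 1)"] tu s
    by (intro mult_left_mono powr_mono2) (auto simp: turn_interval_def)
  finally show ?thesis .
qed

lemma turn_of:
  assumes "t \<ge> 2 * pi"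
  obtains j where "j \<ge> 1" "t \<in> turn_interval j" "t < 2 * pi * (real j + 1)"
proof
  define j where "j = nat \<lfloor>t / (2 * pi)\<rfloor>"
  have one: "1 \<le> t / (2 * pi)" using assms by (simp add: field_simps)
  then have "0 \<le> \<lfloor>t / (2 * pi)\<rfloor>" unfolding zero_le_floor by linarith
  then have "real j = of_int \<lfloor>t / (2 * pi)\<rfloor>" by (simp add: j_def)
  then have j: "real j \<le> t / (2 * pi)" "t / (2 * pi) < real j + 1"
    using of_int_floor_le real_of_int_floor_add_one_gt by metis+
  have "0 < real j" using one j(2) by linarith
  then show "j \<ge> 1" by simp
  show "t < 2 * pi * (real j + 1)" using j by (simp add: field_simps)
  with j show "t \<in> turn_interval j" by (simp add: turn_interval_def field_simps)
qed

lemma strict_mono_parameter: "strict_mono_on {2 * pi..} parameter"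
proof (rule strict_mono_onI)
  fix t u assume tu: "t \<in> {2 * pi..}" "u \<in> {2 * pi..}" "t < u"
  then obtain j where j: "j \<ge> 1" "t \<in> turn_interval j" "t < 2 * pi * (real j + 1)"
    using turn_of[of t] by auto
  define v where "v = min u (2 * pi * (real j + 1))"
  have v: "v \<in> turn_interval j" "t < v" "v \<le> u"
    using j tu by (auto simp: v_def turn_interval_def)
  have "spiral_curve \<phi> t \<noteq> spiral_curve \<phi> v"
    using spiral_curve_inject[of t v] turn_interval_ge[OF j(1)] j(2) v by auto
  then have "0 < turn_max \<phi> j powr (s - 1) * dist (spiral_curve \<phi> t) (spiral_curve \<phi> v)"
    using turn_max_pos[OF j(1)] by simp
  also have "\<dots> \<le> parameter v - parameter t"
    using dist_le_parameter_in_turn[OF j(1,2) v(1)] v(2) by simp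
  finally show "parameter t < parameter u" using parameter_mono[OF v(3)] by simp
qed

text \<open>
  Measure distances in units of the right-hand side without the factor \<open>6\<close>. If \<open>t\<close> lies in turn \<open>j\<close>,
  the end \<open>p\<close> of that turn is at distance at most \<open>2\<close> from \<open>t\<close>. If \<open>u\<close> lies in turn \<open>j\<close> or \<open>j + 1\<close>, the
  estimate on single turns suffices. Otherwise the complete turn \<open>j + 1\<close> lies between, whence
  \<open>\<phi>\<^sub>j\<^sub>+\<^sub>1 \<le> 2\<close>; as \<open>p\<close> and \<open>u\<close> have radius at most \<open>\<phi>\<^sub>j\<^sub>+\<^sub>1\<close>, their distance is at most \<open>4\<close>.
\<close>

lemma holder_parameter:
  assumes "2 * pi \<le> t" "t \<le> u"
  shows "dist (spiral_curve \<phi> t) (spiral_curve \<phi> u) \<le> 6 * (parameter u - parameter t) powr (1 / s)"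
proof -
  let ?\<gamma> = "spiral_curve \<phi>" and ?D = "(parameter u - parameter t) powr (1 / s)"
  have D_mono: "(parameter y - parameter x) powr (1 / s) \<le> ?D" if "t \<le> x" "x \<le> y" "y \<le> u" for x y
    using parameter_mono[OF that(1)] parameter_mono[OF that(2)] parameter_mono[OF that(3)] s
    by (intro powr_mono2) auto
  have D_nonneg: "0 \<le> ?D" by simp
  obtain j where j: "j \<ge> 1" "t \<in> turn_interval j" "t < 2 * pi * (real j + 1)"
    using turn_of[OF assms(1)] .
  define p q where "p = 2 * pi * (real j + 1)" and "q = 2 * pi * (real j + 2)"
  have pq: "p \<le> q" "p \<in> turn_interval j" "p \<in> turn_interval (Suc j)"
    by (simp_all add: p_def q_def turn_interval_def algebra_simps)
  consider "u \<le> p" | "p < u" "u \<le> q" | "q < u" by linarith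
  then show ?thesis
  proof cases
    case 1
    then have "u \<in> turn_interval j"
      using j(2) assms(2) by (simp add: turn_interval_def p_def)
    from holder_in_turn[OF j(1,2) this assms(2)] D_nonneg show ?thesis by linarith
  next
    case 2
    then have u: "u \<in> turn_interval (Suc j)"
      by (simp add: turn_interval_def p_def q_def algebra_simps)
    have "dist (?\<gamma> t) (?\<gamma> p) \<le> 2 * ?D"
      using holder_in_turn[OF j(1,2) pq(2)] D_mono[of t p] j(3) 2 by (simp add: p_def)
    moreover have "dist (?\<gamma> p) (?\<gamma> u) \<le> 2 * ?D"
      using holder_in_turn[OF _ pq(3) u] D_mono[of p u] j(3) 2 by (simp add: p_def)
    ultimately show ?thesis
      using dist_triangle[of "?\<gamma> t" "?\<gamma> u" "?\<gamma> p"] D_nonneg by linarith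
  next
    case 3
    have "dist (?\<gamma> t) (?\<gamma> p) \<le> 2 * ?D"
      using holder_in_turn[OF j(1,2) pq(2)] D_mono[of t p] j(3) 3 pq(1) by (simp add: p_def)
    moreover have "dist (?\<gamma> p) (?\<gamma> u) \<le> 4 * ?D"
    proof -
      have "turn_max \<phi> (Suc j) \<le> 2 * (parameter q - parameter p) powr (1 / s)"
        using turn_max_le_parameter[of "Suc j"] by (simp add: p_def q_def algebra_simps)
      also have "\<dots> \<le> 2 * ?D" using D_mono[of p q] j(3) 3 pq(1) by (simp add: p_def)
      finally have M: "turn_max \<phi> (Suc j) \<le> 2 * ?D" .
      have "dist (?\<gamma> p) (?\<gamma> u) \<le> \<phi> p + \<phi> u"
        using turn_interval_ge[OF j(1) pq(2)] assms by (intro dist_spiral_curve_le) auto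
      moreover have "\<phi> p \<le> turn_max \<phi> (Suc j)" "\<phi> u \<le> turn_max \<phi> (Suc j)"
        using 3 pq(1) by (auto intro!: radius_le_turn_max simp: p_def add.commute)
      ultimately show ?thesis using M by linarith
    qed
    ultimately show ?thesis
      using dist_triangle[of "?\<gamma> t" "?\<gamma> u" "?\<gamma> p"] by linarith
  qed
qed

lemma holder_arc_spiral: "holder_arc (1 / s) (spiral \<phi>)"
  unfolding spiral_def
proof (rule holder_arc_of_ray[where \<tau> = parameter and K = 6])
  show "inj_on (spiral_curve \<phi>) {2 * pi..}" using arc by (simp add: spiral_arc_def)
  show "(spiral_curve \<phi> \<longlongrightarrow> 0) at_top"
  proof (rule tendsto_norm_zero_cancel, rule Lim_transform_eventually[OF lim])
    show "\<forall>\<^sub>F t in at_top. \<phi> t = norm (spiral_curve \<phi> t)"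
      using eventually_ge_at_top[of "2 * pi"]
      by eventually_elim (use pos in \<open>simp add: norm_spiral_curve less_imp_le\<close>)
  qed
  show "0 \<notin> spiral_curve \<phi> ` {2 * pi..}" using spiral_curve_nonzero by force
  show "continuous_on {2 * pi..} parameter"
    by (rule continuous_on_subset[OF continuous_parameter]) simp
  show "bdd_above (parameter ` {2 * pi..})"
    by (rule bdd_aboveI2) (rule parameter_le)
  show "1 / s > 0" using s by simp
  show "strict_mono_on {2 * pi..} parameter" by (rule strict_mono_parameter)
  show "parameter (2 * pi) = 0" by (rule parameter_start)
  show "dist (spiral_curve \<phi> t) (spiral_curve \<phi> u) \<le> 6 * (parameter u - parameter t) powr (1 / s)"
    if "2 * pi \<le> t" "t \<le> u" for t u
    by (rule holder_parameter[OF that])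
qed simp

end

theorem theorem1p1:
  fixes s :: real and \<phi> :: "real \<Rightarrow> real"
  assumes "s > 1"
    and "continuous_on {2 * pi..} \<phi>"
    and "\<And>t. t \<ge> 2 * pi \<Longrightarrow> \<phi> t > 0"
    and "(\<phi> \<longlongrightarrow> 0) at_top"
    and "spiral_arc \<phi>"
    and "almost_circular \<phi>"
  shows "holder_arc (1 / s) (spiral \<phi>) \<longleftrightarrow> summable (\<lambda>n. turn_max \<phi> (Suc n) powr s)"
proof -
  interpret positive_spiral_arc \<phi> by unfold_locales (fact assms)+
  show ?thesis
  proof
    assume "holder_arc (1 / s) (spiral \<phi>)"
    then show "summable (\<lambda>n. turn_max \<phi> (Suc n) powr s)"
      using assms(1) by (intro summable_of_holder_arc) auto
  next
    assume summable: "summable (\<lambda>n. turn_max \<phi> (Suc n) powr s)"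
    obtain C where C: "C > 0" "\<forall>j\<ge>1. curve_length (spiral_curve \<phi>) (2 * pi * real j) (2 * pi * (real j + 1))
        \<le> ennreal (C * turn_max \<phi> j)"
      using assms(6) unfolding almost_circular_def by blast
    interpret summable_spiral_arc \<phi> s C
    proof
      show "s > 1" "C > 0" "summable (\<lambda>n. turn_max \<phi> (Suc n) powr s)" by fact+
      show "curve_length (spiral_curve \<phi>) (2 * pi * real j) (2 * pi * (real j + 1))
          \<le> ennreal (C * turn_max \<phi> j)" if "j \<ge> 1" for j
        using C(2) that by blast
    qed
    show "holder_arc (1 / s) (spiral \<phi>)" by (rule holder_arc_spiral)
  qed
qed

end
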